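(* Let $q$ be a prime, $n\ge 1$, $f:\mathbb{Z}_q^n\to\mathbb{Z}_q$ an arbitrary function, $a\in\mathbb{Z}_q$, and let $W$ be a nonempty proper subset of $\{1,\ldots,n,0\}$. Then the $n$-ary quasigroup $Q_{f,a}$ is $W$-separable if and only if the partial function $f^{[0]}$ is $W$-separable.
   Context: Let $q$ be prime. Partial functions: for $c\in\mathbb{Z}_q$ put $\Omega_c=\{(x_1,\ldots,x_n,x_0)\in\mathbb{Z}_q^{n+1}\mid \sum_{i=0}^n x_i=c\}$. For $f:\mathbb{Z}_q^n\to\mathbb{Z}_q$, its $c$-extension is the partial function $f^{[c]}:\Omega_c\to\mathbb{Z}_q$ given by $f^{[c]}(x_1,\ldots,x_n,x_0)=f(x_1,\ldots,x_n)$. For $W\subset\{1,\ldots,n,0\}$ and $U=\{1,\ldots,n,0\}\setminus W$, the partial function $f^{[c]}$ is $W$-separable if $f^{[c]}(x_1,\ldots,x_n,x_0)=f'(x_W)+f''(x_U)$ on $\Omega_c$ for some everywhere defined $\mathbb{Z}_q$-valued functions $f',f''$ of $|W|$ and $|U|$ arguments in $\mathbb{Z}_q$, where $x_C$ denotes the tuple of variables with indices in $C$. Quasigroups: an $n$-ary quasigroup on a set $\Sigma$ (of order $|\Sigma|$) is an operation $Q:\Sigma^n\to\Sigma$ such that in the equation $x_0=Q(x_1,\ldots,x_n)$ the values of any $n$ of the variables $x_0,\ldots,x_n$ uniquely determine the value of the remaining one. For nonempty $W\subset\{1,\ldots,n\}$, $Q$ is $W$-separable if $Q(\bar x)=G(\bar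 x',H(\bar x''))$ for some $|W|$-ary quasigroup $H$ and some $(n-|W|+1)$-ary quasigroup $G$ on $\Sigma$, where $\bar x''$ is the tuple of variables from $\bar x=(x_1,\ldots,x_n)$ with indices in $W$ and $\bar x'$ is the tuple of all other variables of $\bar x$. By definition, if $Q$ is $W$-separable then it is also considered $\{1,\ldots,n,0\}\setminus W$-separable; i.e. for $W\ni 0$, $W$-separability means $\{1,\ldots,n,0\}\setminus W$-separability. The quasigroup $Q_{f,a}$: let $\Sigma=\{[x,y]\mid x,y\in\mathbb{Z}_q\}$ (so $|\Sigma|=q^2$). For $f:\mathbb{Z}_q^n\to\mathbb{Z}_q$ and $a\in\mathbb{Z}_q$, $$Q_{f,a}([x_1,y_1],\ldots,[x_n,y_n])=\Big[-\sum_{i=1}^n x_i+a,\ -\sum_{i=1}^n y_i+f(x_1,\ldots,x_n)\Big].$$ *)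

theory Defs
  imports "Berlekamp_Zassenhaus.Finite_Field" "HOL-Library.FuncSet"
begin

(* The field of residues modulo a prime q is the type 'q mod_ring with 'q :: prime_card
   and q = CARD('q).
   A tuple x_I over a finite set I of indices is an extensional function on I, that is, an
   element of tuples I; the subtuple x_C is restrict x C. *)

abbreviation tuples :: "'i set \<Rightarrow> ('i \<Rightarrow> 'a) set"
  where "tuples I \<equiv> (\<Pi>\<^sub>E i\<in>I. UNIV)"


(* The tuples (x_1, ..., x_n, x_0) are indexed by {0..n}. *)

definition Omega :: "nat \<Rightarrow> 'q::prime_card mod_ring \<Rightarrow> (nat \<Rightarrow> 'q mod_ring) set"
  where "Omega n c = {x \<in> tuples {0..n}. (\<Sum>i=0..n. x i) = c}"

definition extension ::
    "nat \<Rightarrow> ((nat \<Rightarrow> 'q mod_ring) \<Rightarrow> 'q::prime_card mod_ring) \<Rightarrow> 'q mod_ring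
      \<Rightarrow> (nat \<Rightarrow> 'q mod_ring) \<rightharpoonup> 'q mod_ring"
  where "extension n f c =
    (\<lambda>x. if x \<in> Omega n c then Some (f (restrict x {1..n})) else None)"

definition partial_separable ::
    "nat \<Rightarrow> nat set \<Rightarrow> ((nat \<Rightarrow> 'q mod_ring) \<rightharpoonup> 'q::prime_card mod_ring) \<Rightarrow> bool"
  where "partial_separable n W g \<longleftrightarrow>
    (\<exists>f' f''. \<forall>x\<in>dom g. g x = Some (f' (restrict x W) + f'' (restrict x ({0..n} - W))))"


(* A quasigroup on the type 'a whose arguments are indexed by I; its arity is card I.
   The values of the arguments determine the value of the operation, so only the
   solvability in each argument is to be required. *)

definition quasigroup :: "'i set \<Rightarrow> (('i \<Rightarrow> 'a) \<Rightarrow> 'a) \<Rightarrow> bool"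
  where "quasigroup I Q \<longleftrightarrow>
    finite I \<and> (\<forall>i\<in>I. \<forall>x\<in>tuples I. \<forall>b. \<exists>!a. Q (x(i := a)) = b)"

(* Q x = G (x', H x''). The arguments of Q are indexed by {1..n}, so the index 0 is free to
   stand for the argument of G that receives the value of H. *)

definition inner_separable :: "nat \<Rightarrow> nat set \<Rightarrow> ((nat \<Rightarrow> 'a) \<Rightarrow> 'a) \<Rightarrow> bool"
  where "inner_separable n W Q \<longleftrightarrow>
    (\<exists>G H. quasigroup (insert 0 ({1..n} - W)) G \<and> quasigroup W H \<and>
      (\<forall>x\<in>tuples {1..n}. Q x = G ((restrict x ({1..n} - W))(0 := H (restrict x W)))))"

definition quasigroup_separable :: "nat \<Rightarrow> nat set \<Rightarrow> ((nat \<Rightarrow> 'a) \<Rightarrow> 'a) \<Rightarrow> bool"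
  where "quasigroup_separable n W Q \<longleftrightarrow>
    (if 0 \<in> W then inner_separable n ({0..n} - W) Q else inner_separable n W Q)"


definition Qfa ::
    "nat \<Rightarrow> ((nat \<Rightarrow> 'q mod_ring) \<Rightarrow> 'q::prime_card mod_ring) \<Rightarrow> 'q mod_ring
      \<Rightarrow> (nat \<Rightarrow> 'q mod_ring \<times> 'q mod_ring) \<Rightarrow> 'q mod_ring \<times> 'q mod_ring"
  where "Qfa n f a z =
    (- (\<Sum>i=1..n. fst (z i)) + a,
     - (\<Sum>i=1..n. snd (z i)) + f (\<lambda>i\<in>{1..n}. fst (z i)))"

lemma quasigroup_Qfa: "quasigroup {1..n} (Qfa n f a)"
  unfolding quasigroup_def
proof (intro conjI ballI allI)
  fix i and z :: "nat \<Rightarrow> 'a mod_ring \<times> 'a mod_ring" and b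
  assume i: "i \<in> {1..n}"
  define s where "s = (\<Sum>j\<in>{1..n} - {i}. fst (z j))"
  define t where "t = (\<Sum>j\<in>{1..n} - {i}. snd (z j))"
  define F where "F u = f (\<lambda>j\<in>{1..n}. if j = i then u else fst (z j))" for u
  have s: "(\<Sum>j=1..n. fst ((z(i := c)) j)) = fst c + s" for c
    using i by (subst sum.remove[of _ i]) (auto simp: s_def intro!: sum.cong)
  have t: "(\<Sum>j=1..n. snd ((z(i := c)) j)) = snd c + t" for c
    using i by (subst sum.remove[of _ i]) (auto simp: t_def intro!: sum.cong)
  have F: "f (\<lambda>j\<in>{1..n}. fst ((z(i := c)) j)) = F (fst c)" for c
    unfolding F_def by (rule arg_cong[of _ _ f]) (auto simp: restrict_def)
  have Q: "Qfa n f a (z(i := c)) = (- (fst c + s) + a, - (snd c + t) + F (fst c))" for c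
    unfolding Qfa_def s t F ..
  show "\<exists>!c. Qfa n f a (z(i := c)) = b"
  proof (rule ex1I)
    show "Qfa n f a (z(i := (a - s - fst b, F (a - s - fst b) - t - snd b))) = b"
      unfolding Q by (simp add: algebra_simps prod_eq_iff)
  next
    fix c assume "Qfa n f a (z(i := c)) = b"
    then have b: "b = (- (fst c + s) + a, - (snd c + t) + F (fst c))"
      unfolding Q by simp
    then have "fst c = a - s - fst b" by simp
    moreover from b have "snd c = F (fst c) - t - snd b" by simp
    ultimately show "c = (a - s - fst b, F (a - s - fst b) - t - snd b)"
      by (simp add: prod_eq_iff)
  qed
qed simp

end

theory Submission
  imports Defs
begin

text \<open>
  Interchanging \<open>W\<close> with its complement affects neither side of the equivalence, so let
  \<open>0 \<notin> W\<close>, and let \<open>U\<close> be the rest of \<open>{1..n}\<close>. Since \<open>x\<^sub>0\<close> is determined on the domain of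
  the extension by the sum over \<open>W\<close> and by \<open>x\<^sub>U\<close>, separability of the extension says that
  \<open>f x = f' x\<^sub>W + g x\<^sub>U s\<close>, where \<open>s\<close> is the sum of \<open>x\<^sub>W\<close>. In other words, whenever two tuples
  over \<open>W\<close> have the same sum, exchanging one for the other changes \<open>f\<close> by an amount that does
  not depend on \<open>x\<^sub>U\<close>.

  A decomposition of \<open>Qfa n f a\<close> forces this (\<open>inner_separable_imp_exchange\<close>): the second
  coordinates over \<open>W\<close> can be shifted so that the two tuples give the same value of the
  quasigroup for one \<open>x\<^sub>U\<close>. Then the inner operation does not distinguish them, so they give the
  same value for every \<open>x\<^sub>U\<close>. Conversely, from \<open>f'\<close> and \<open>g\<close> the inner operation sums both
  coordinates over \<open>W\<close> and corrects the second sum by \<open>f'\<close>; the outer one does the same with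
  the remaining coordinates and \<open>g\<close>, which it can evaluate because \<open>s\<close> is the first coordinate of
  the value of the inner operation.
\<close>

lemma partial_separable_extension_iff:
  "partial_separable n W (extension n f c) \<longleftrightarrow>
    (\<exists>f' f''. \<forall>x\<in>Omega n c.
      f (restrict x {1..n}) = f' (restrict x W) + f'' (restrict x ({0..n} - W)))"
proof -
  have "dom (extension n f c) = Omega n c"
    by (auto simp: extension_def dom_def)
  then show ?thesis
    by (simp add: partial_separable_def extension_def)
qed

lemma partial_separable_complement:
  assumes "W \<subseteq> {0..n}"
  shows "partial_separable n ({0..n} - W) g \<longleftrightarrow> partial_separable n W g"
proof -
  have "partial_separable n ({0..n} - V) g" if "V \<subseteq> {0..n}" "partial_separable n V g" for V
  proof -
    have V: "{0..n} - ({0..n} - V) = V" using that(1) by blast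
    show ?thesis
      using that(2) unfolding partial_separable_def V by (metis add.commute)
  qed
  from this[of W] this[of "{0..n} - W"] show ?thesis
    using assms by (auto simp: double_diff)
qed

lemma quasigroup_comp_bij:
  assumes "quasigroup I Q" "bij \<sigma>"
  shows "quasigroup I (\<lambda>z. \<sigma> (Q z))"
proof -
  have "\<sigma> c = b \<longleftrightarrow> c = inv_into UNIV \<sigma> b" for c b
    using assms(2) by (metis bij_inv_eq_iff)
  then show ?thesis
    using assms(1) by (simp add: quasigroup_def)
qed

text \<open>
  A skew product of two copies of addition: the equation in one argument is triangular, because
  the correction \<open>F\<close> of the second coordinate depends only on first coordinates, which the first
  equation determines.
\<close>
lemma quasigroup_skew_sum:
  fixes F :: "('i \<Rightarrow> 'a::ab_group_add) \<Rightarrow> 'b::ab_group_add"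
  assumes "finite I"
  shows "quasigroup I
    (\<lambda>z. (\<Sum>i\<in>I. fst (z i), (\<Sum>i\<in>I. snd (z i)) - F (\<lambda>i\<in>I. fst (z i))))"
  unfolding quasigroup_def
proof (intro conjI ballI allI)
  fix i and z :: "'i \<Rightarrow> 'a \<times> 'b" and b
  assume i: "i \<in> I"
  define s where "s = (\<Sum>j\<in>I - {i}. fst (z j))"
  define t where "t = (\<Sum>j\<in>I - {i}. snd (z j))"
  define E where "E u = F (\<lambda>j\<in>I. if j = i then u else fst (z j))" for u
  have s: "(\<Sum>j\<in>I. fst ((z(i := c)) j)) = fst c + s" for c
    using i assms by (subst sum.remove[of _ i]) (auto simp: s_def intro!: sum.cong)
  have t: "(\<Sum>j\<in>I. snd ((z(i := c)) j)) = snd c + t" for c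
    using i assms by (subst sum.remove[of _ i]) (auto simp: t_def intro!: sum.cong)
  have E: "F (\<lambda>j\<in>I. fst ((z(i := c)) j)) = E (fst c)" for c
    unfolding E_def by (rule arg_cong[of _ _ F]) (auto simp: restrict_def)
  show "\<exists>!c. (\<Sum>j\<in>I. fst ((z(i := c)) j),
      (\<Sum>j\<in>I. snd ((z(i := c)) j)) - F (\<lambda>j\<in>I. fst ((z(i := c)) j))) = b"
    unfolding s t E
  proof (rule ex1I)
    show "(fst (fst b - s, snd b + E (fst b - s) - t) + s,
        snd (fst b - s, snd b + E (fst b - s) - t) + t
          - E (fst (fst b - s, snd b + E (fst b - s) - t))) = b"
      by simp
  next
    fix c assume "(fst c + s, snd c + t - E (fst c)) = b"
    then have "fst b = fst c + s" "snd b = snd c + t - E (fst c)"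
      by auto
    then show "c = (fst b - s, snd b + E (fst b - s) - t)"
      by (simp add: prod_eq_iff)
  qed
qed (fact assms)

text \<open>
  The tuple \<open>override_on u p W\<close> carries \<open>p\<close> on \<open>W\<close> and \<open>u\<close> elsewhere. The values of \<open>H\<close> on
  two inputs agree as soon as \<open>G\<close> gives the same value on them for a single choice of the other
  arguments, here \<open>w\<close>; a shift \<open>d\<close> of one second coordinate brings about this equality.
\<close>
lemma inner_separable_imp_exchange:
  fixes f :: "(nat \<Rightarrow> 'q::prime_card mod_ring) \<Rightarrow> 'q mod_ring"
  assumes sep: "inner_separable n W (Qfa n f a)"
    and W: "W \<subseteq> {1..n}" "W \<noteq> {}"
    and sums: "sum p W = sum r W"
  shows "f (restrict (override_on u p W) {1..n}) - f (restrict (override_on u r W) {1..n}) =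
         f (restrict (override_on w p W) {1..n}) - f (restrict (override_on w r W) {1..n})"
proof -
  obtain G H where G: "quasigroup (insert 0 ({1..n} - W)) G"
    and Q: "\<And>x. x \<in> tuples {1..n} \<Longrightarrow>
      Qfa n f a x = G ((restrict x ({1..n} - W))(0 := H (restrict x W)))"
    using sep unfolding inner_separable_def by blast
  obtain v where v: "v \<in> W" using W by blast
  define D where "D p u = f (restrict (override_on u p W) {1..n})" for p u
  define d where "d = D p w - D r w"
  define z where "z p u c = (\<lambda>i\<in>{1..n}. (override_on u p W i, if i = v then c else 0))"
    for p u :: "nat \<Rightarrow> 'q mod_ring" and c :: "'q mod_ring"
  have z_tuple: "z p u c \<in> tuples {1..n}" for p u c
    by (simp add: z_def)
  have z_outer: "restrict (z p u c) ({1..n} - W) = (\<lambda>i\<in>{1..n} - W. (u i, 0))" for p u c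
    using v by (auto simp: z_def restrict_def override_on_def fun_eq_iff)
  have z_inner: "restrict (z p u c) W = (\<lambda>i\<in>W. (p i, if i = v then c else 0))" for p u c
    using W by (auto simp: z_def restrict_def override_on_def fun_eq_iff)
  have fst_sum: "(\<Sum>i=1..n. fst (z p u c i)) = sum p W + sum u ({1..n} - W)" for p u c
  proof -
    have "(\<Sum>i=1..n. fst (z p u c i)) = (\<Sum>i=1..n. override_on u p W i)"
      by (simp add: z_def)
    also have "\<dots> = sum (override_on u p W) W + sum (override_on u p W) ({1..n} - W)"
      using W by (simp add: sum.subset_diff add.commute)
    finally show ?thesis by (simp add: override_on_def)
  qed
  have snd_sum: "(\<Sum>i=1..n. snd (z p u c i)) = c" for p u c
  proof -
    have "(\<Sum>i=1..n. snd (z p u c i)) = (\<Sum>i=1..n. if i = v then c else 0)"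
      by (simp add: z_def)
    then show ?thesis using v W by auto
  qed
  have fz: "f (\<lambda>i\<in>{1..n}. fst (z p u c i)) = D p u" for p u c
    unfolding D_def by (rule arg_cong[of _ _ f]) (auto simp: z_def restrict_def)
  have Qz: "Qfa n f a (z p u c) = (- (sum p W + sum u ({1..n} - W)) + a, - c + D p u)" for p u c
    unfolding Qfa_def fst_sum snd_sum fz ..
  have QGH: "Qfa n f a (z p u c) = G ((\<lambda>i\<in>{1..n} - W. (u i, 0))
      (0 := H (\<lambda>i\<in>W. (p i, if i = v then c else 0))))" for p u c
    using Q[OF z_tuple, of p u c] unfolding z_outer z_inner .
  have "(\<lambda>i\<in>insert 0 ({1..n} - W). (w i, 0::'q mod_ring)) \<in> tuples (insert 0 ({1..n} - W))"
    by simp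
  then have "\<exists>!h. G ((\<lambda>i\<in>insert 0 ({1..n} - W). (w i, 0))(0 := h)) = b" for b
    using G unfolding quasigroup_def by blast
  moreover have "(\<lambda>i\<in>insert 0 ({1..n} - W). (w i, 0::'q mod_ring))(0 := h)
      = (\<lambda>i\<in>{1..n} - W. (w i, 0))(0 := h)" for h
    by (auto simp: fun_eq_iff restrict_def)
  ultimately have "\<exists>!h. G ((\<lambda>i\<in>{1..n} - W. (w i, 0))(0 := h)) = b" for b
    by (simp only:)
  moreover have "Qfa n f a (z p w d) = Qfa n f a (z r w 0)"
    unfolding Qz by (simp add: sums d_def)
  ultimately have "H (\<lambda>i\<in>W. (p i, if i = v then d else 0))
      = H (\<lambda>i\<in>W. (r i, if i = v then 0 else 0))"
    unfolding QGH by blast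
  then have "Qfa n f a (z p u d) = Qfa n f a (z r u 0)"
    unfolding QGH by simp
  then have "- d + D p u = D r u"
    unfolding Qz by simp
  then show ?thesis
    unfolding d_def D_def by (simp add: algebra_simps)
qed

lemma inner_separable_imp_partial_separable:
  assumes sep: "inner_separable n W (Qfa n f a)"
    and W: "W \<subseteq> {1..n}" "W \<noteq> {}"
  shows "partial_separable n W (extension n f 0)"
proof -
  obtain v where v: "v \<in> W" using W by blast
  \<comment> \<open>a representative of the tuples over \<open>W\<close> with sum \<open>s\<close>\<close>
  define r where "r s = (\<lambda>i. if i = v then s else 0)" for s :: "'a mod_ring"
  define D where "D p u = f (restrict (override_on u p W) {1..n})" for p u
  define f' where "f' x = D x (\<lambda>_. 0)" for x
  define f'' where "f'' u = D (r (- sum u ({0..n} - W))) u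
      - D (r (- sum u ({0..n} - W))) (\<lambda>_. 0)" for u
  have "f (restrict x {1..n}) = f' (restrict x W) + f'' (restrict x ({0..n} - W))"
    if x: "x \<in> Omega n 0" for x
  proof -
    have "sum x W + sum x ({0..n} - W) = 0"
      using x W sum.subset_diff[of W "{0..n}" x]
      by (force simp: Omega_def add.commute)
    then have s: "- sum x ({0..n} - W) = sum x W"
      by (metis minus_unique add.commute)
    have "sum (r (sum x W)) W = sum x W"
      using v finite_subset[OF W(1)] by (simp add: r_def)
    then have "D x x - D (r (sum x W)) x
        = D x (\<lambda>_. 0) - D (r (sum x W)) (\<lambda>_. 0)"
      unfolding D_def by (intro inner_separable_imp_exchange[OF sep W]) simp
    moreover have "D (restrict x W) u = D x u" for u
      unfolding D_def by (rule arg_cong[of _ _ f]) (auto simp: override_on_def restrict_def)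
    moreover have "D p (restrict x ({0..n} - W)) = D p x" for p
      unfolding D_def by (rule arg_cong[of _ _ f]) (auto simp: override_on_def restrict_def)
    moreover have "D x x = f (restrict x {1..n})"
      by (simp add: D_def override_on_def)
    ultimately show ?thesis
      unfolding f'_def f''_def by (simp add: s algebra_simps)
  qed
  then show ?thesis
    unfolding partial_separable_extension_iff by blast
qed

lemma partial_separable_imp_inner_separable:
  fixes f :: "(nat \<Rightarrow> 'q::prime_card mod_ring) \<Rightarrow> 'q mod_ring"
  assumes sep: "partial_separable n W (extension n f 0)"
    and W: "W \<subseteq> {1..n}"
  shows "inner_separable n W (Qfa n f a)"
proof -
  obtain f' f'' where f: "\<And>x. x \<in> Omega n 0 \<Longrightarrow>
      f (restrict x {1..n}) = f' (restrict x W) + f'' (restrict x ({0..n} - W))"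
    using sep unfolding partial_separable_extension_iff by blast
  define U where "U = {1..n} - W"
  have U: "finite U" "0 \<notin> U" "{0..n} - W = insert 0 U"
    using W by (auto simp: U_def)
  have W': "finite W" "0 \<notin> W"
    using W finite_subset by auto
  have split: "(\<Sum>i=1..n. h i) = sum h W + sum h U" for h :: "nat \<Rightarrow> 'q mod_ring"
    using W unfolding U_def by (simp add: sum.subset_diff add.commute)
  \<comment> \<open>The argument \<open>0\<close> of the outer operation carries the sum over \<open>W\<close>, so the sum of all its
    first coordinates is \<open>- x\<^sub>0\<close>, and \<open>x\<^sub>0\<close> is what \<open>f''\<close> expects at the index \<open>0\<close>.\<close>
  define F where "F x = f'' (x(0 := - sum x (insert 0 U)))" for x
  define H where "H z = (\<Sum>i\<in>W. fst (z i), (\<Sum>i\<in>W. snd (z i)) - f' (\<lambda>i\<in>W. fst (z i)))"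
    for z :: "nat \<Rightarrow> 'q mod_ring \<times> 'q mod_ring"
  define K where "K z = (\<Sum>i\<in>insert 0 U. fst (z i),
      (\<Sum>i\<in>insert 0 U. snd (z i)) - F (\<lambda>i\<in>insert 0 U. fst (z i)))"
    for z :: "nat \<Rightarrow> 'q mod_ring \<times> 'q mod_ring"
  define \<sigma> where "\<sigma> c = (- fst c + a, - snd c)"
    for c :: "'q mod_ring \<times> 'q mod_ring"
  have "bij \<sigma>"
    by (rule bij_betw_byWitness[where f' = "\<lambda>c. (a - fst c, - snd c)"]) (auto simp: \<sigma>_def)
  moreover have "quasigroup (insert 0 U) K"
    unfolding K_def by (rule quasigroup_skew_sum) (simp add: U)
  ultimately have G: "quasigroup (insert 0 U) (\<lambda>z. \<sigma> (K z))"
    by (rule quasigroup_comp_bij[rotated])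
  have H: "quasigroup W H"
    unfolding H_def by (rule quasigroup_skew_sum) (simp add: W')
  have "Qfa n f a z = \<sigma> (K ((restrict z U)(0 := H (restrict z W))))" for z
  proof -
    define x where "x = (\<lambda>i. fst (z i))"
    define x' where "x' = restrict (x(0 := - (sum x W + sum x U))) {0..n}"
    define k where "k = (restrict z U)(0 := H (restrict z W))"
    have "sum x' {0..n} = x' 0 + (\<Sum>i=1..n. x' i)"
      by (simp add: sum.atLeast_Suc_atMost)
    also have "(\<Sum>i=1..n. x' i) = sum x W + sum x U"
      unfolding split[symmetric] by (rule sum.cong) (auto simp: x'_def)
    also have "x' 0 = - (sum x W + sum x U)"
      by (simp add: x'_def)
    finally have "sum x' {0..n} = 0"
      by simp
    moreover have "x' \<in> tuples {0..n}"
      by (simp add: x'_def)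
    ultimately have "x' \<in> Omega n 0"
      by (simp add: Omega_def)
    note fx = f[OF this]
    have "restrict x' {1..n} = restrict x {1..n}"
      by (auto simp: x'_def restrict_def)
    moreover have "restrict x' W = restrict x W"
      using W by (auto simp: x'_def restrict_def fun_eq_iff)
    moreover have "restrict x' ({0..n} - W)
        = (restrict x U)(0 := - (sum x W + sum x U))"
      unfolding U(3) by (auto simp: x'_def U_def restrict_def fun_eq_iff)
    ultimately have fx: "f (restrict x {1..n}) =
        f' (restrict x W) + f'' ((restrict x U)(0 := - (sum x W + sum x U)))"
      using fx by simp
    have Hz: "H (restrict z W) = (sum x W, (\<Sum>i\<in>W. snd (z i)) - f' (restrict x W))"
      by (simp add: H_def x_def cong: restrict_cong)
    have k: "k 0 = H (restrict z W)" "\<And>i. i \<in> U \<Longrightarrow> k i = z i"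
      using U by (auto simp: k_def)
    have fst_k: "(\<Sum>i\<in>insert 0 U. fst (k i)) = sum x W + sum x U"
      using U by (simp add: k Hz) (simp add: x_def)
    have snd_k: "(\<Sum>i\<in>insert 0 U. snd (k i))
        = (\<Sum>i\<in>W. snd (z i)) - f' (restrict x W) + (\<Sum>i\<in>U. snd (z i))"
      using U by (simp add: k Hz)
    have "(\<lambda>i\<in>insert 0 U. fst (k i))(0 := c) = (restrict x U)(0 := c)" for c
      by (auto simp: k x_def restrict_def fun_eq_iff)
    moreover have "sum (\<lambda>i\<in>insert 0 U. fst (k i)) (insert 0 U) = sum x W + sum x U"
      by (subst fst_k[symmetric]) (rule sum.cong, auto)
    ultimately have "F (\<lambda>i\<in>insert 0 U. fst (k i))
        = f'' ((restrict x U)(0 := - (sum x W + sum x U)))"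
      by (simp add: F_def)
    then have "\<sigma> (K k) = (- (sum x W + sum x U) + a,
        - (\<Sum>i\<in>W. snd (z i)) - (\<Sum>i\<in>U. snd (z i)) + f (restrict x {1..n}))"
      unfolding K_def \<sigma>_def fst_k snd_k fx by (simp add: algebra_simps)
    then show ?thesis
      unfolding Qfa_def split k_def x_def by (simp add: algebra_simps)
  qed
  with G H show ?thesis
    unfolding inner_separable_def U_def by blast
qed

theorem mainTheorem4:
  fixes n :: nat
    and f :: "(nat \<Rightarrow> 'q::prime_card mod_ring) \<Rightarrow> 'q mod_ring"
    and a :: "'q mod_ring"
    and W :: "nat set"
  assumes "n \<ge> 1"
    and "W \<noteq> {}" and "W \<subset> {0..n}"
  shows "quasigroup_separable n W (Qfa n f a) \<longleftrightarrow> partial_separable n W (extension n f 0)"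
proof -
  have inner: "inner_separable n V (Qfa n f a) \<longleftrightarrow> partial_separable n V (extension n f 0)"
    if "V \<subseteq> {0..n}" "0 \<notin> V" "V \<noteq> {}" for V
  proof -
    have "V \<subseteq> {1..n}"
      using that by (metis One_nat_def atLeastAtMost_iff not_less_eq_eq le_zero_eq subset_iff)
    then show ?thesis
      using that(3) inner_separable_imp_partial_separable[of n V f a]
        partial_separable_imp_inner_separable[of n V f a] by blast
  qed
  show ?thesis
  proof (cases "0 \<in> W")
    case True
    then show ?thesis
      using inner[of "{0..n} - W"] assms partial_separable_complement[of W n]
      by (auto simp: quasigroup_separable_def)
  next
    case False
    then show ?thesis
      using inner[of W] assms by (auto simp: quasigroup_separable_def)
  qed
qed

end
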